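(* Let $A=(a_{ij})_{m\times m}$ be a complex Hermitian matrix with (real) eigenvalues $\lambda_0(A),\dots,\lambda_{m-1}(A)$, and let $\tilde\lambda=\sup_{0\le i\le m-1}|\lambda_i(A)|$. Suppose that $f(t)=\sum_{k=0}^{\infty}f_kt^k$ is an analytic function with radius of convergence $R_f$ such that $f_k$ is real for each $k$ and $f(t)$ is (strictly) increasing for all real $t$ in its domain. Then for all real $t>\tilde\lambda/R_f$, the largest eigenvalue of $A$ is bounded from below by $$t\,f^{-1}\left(\frac1m\sum_{k=0}^{\infty}f_kN_kt^{-k}\right),$$ where $N_k=u^TA^ku=\sum_{i=1}^m\sum_{j=1}^m(A^k)_{ij}$, $N_0=m$, and $u=[1,1,\dots,1]^T$ is the $m\times 1$ all-ones vector.
   Context: The radius of convergence satisfies $0<R_f\le\infty$, with $\tilde\lambda/R_f$ read as $0$ when $R_f=\infty$. $f^{-1}$ denotes the inverse of $f$ as a strictly increasing function of a real variable on its real domain. *)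

theory Defs
  imports
    "HOL-Analysis.Summation_Tests"
    "Jordan_Normal_Form.Schur_Decomposition"
    "Jordan_Normal_Form.Spectral_Radius"
begin

definition hermitian_mat :: "complex mat \<Rightarrow> bool" where
  "hermitian_mat A \<longleftrightarrow> square_mat A \<and> mat_adjoint A = A"

text \<open>Only used for Hermitian matrices of positive dimension, whose eigenvalues are all real; the
  set below is then the whole (finite, nonempty) spectrum.\<close>

definition largest_eigenvalue :: "complex mat \<Rightarrow> real" where
  "largest_eigenvalue A = Max {x. eigenvalue A (complex_of_real x)}"

definition ones_vec :: "nat \<Rightarrow> complex vec" where
  "ones_vec m = Matrix.vec m (\<lambda>_. 1)"

text \<open>The number $N_k = u^T A^k u$; \<^const>\<open>scalar_prod\<close> is bilinear, without conjugation.\<close>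

definition walk_num :: "complex mat \<Rightarrow> nat \<Rightarrow> complex" where
  "walk_num A k =
     scalar_prod (ones_vec (dim_row A)) ((A ^\<^sub>m k) *\<^sub>v ones_vec (dim_row A))"

lemma walk_num_eq_sum:
  assumes "A \<in> carrier_mat m m"
  shows "walk_num A k = (\<Sum>i<m. \<Sum>j<m. (A ^\<^sub>m k) $$ (i, j))"
proof -
  have "A ^\<^sub>m k \<in> carrier_mat m m"
    using assms by (rule pow_carrier_mat)
  with assms show ?thesis
    by (auto simp: walk_num_def ones_vec_def scalar_prod_def lessThan_atLeast0 intro!: sum.cong)
qed

lemma walk_num_0:
  assumes "A \<in> carrier_mat m m"
  shows "walk_num A 0 = of_nat m"
  using assms by (simp add: walk_num_def ones_vec_def scalar_prod_def)

text \<open>The open interval $(-R, R)$, with $R$ the (possibly infinite) radius of convergence of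
  $\sum_k c_k t^k$.\<close>

definition real_domain :: "(nat \<Rightarrow> real) \<Rightarrow> real set" where
  "real_domain c = {x. ereal \<bar>x\<bar> < conv_radius c}"

end

theory Submission
  imports Defs
begin

text \<open>Splitting the all-ones vector into eigenvectors of the Hermitian matrix \<open>A\<close>, with component
  \<open>w\<^sub>\<nu>\<close> for the eigenvalue \<open>\<nu>\<close>, gives \<open>N\<^sub>k = \<Sum>\<^sub>\<nu> p\<^sub>\<nu> \<nu>\<^sup>k\<close> with weights
  \<open>p\<^sub>\<nu> = |w\<^sub>\<nu>|\<^sup>2 \<ge> 0\<close> of total mass \<open>N\<^sub>0 = m\<close>. Hence the series divided by \<open>m\<close> is a weighted mean of
  the values \<open>f (\<nu> / t)\<close>. By the intermediate value theorem this mean is attained by \<open>f\<close> between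
  the smallest and the largest of the points \<open>\<nu> / t\<close>.\<close>

section \<open>Finite sums of vectors\<close>

text \<open>Vectors of all dimensions share one type, so the dimension is an explicit argument; the
  empty sum is then the zero vector of dimension \<open>n\<close>.\<close>

definition vsum :: "nat \<Rightarrow> 'b set \<Rightarrow> ('b \<Rightarrow> complex vec) \<Rightarrow> complex vec" where
  "vsum n S w = Matrix.vec n (\<lambda>i. \<Sum>\<nu>\<in>S. w \<nu> $ i)"

lemma vsum_carrier [simp]: "vsum n S w \<in> carrier_vec n"
  by (simp add: vsum_def)

lemma mult_mat_vec_index:
  assumes "A \<in> carrier_mat n k" "v \<in> carrier_vec k" "i < n"
  shows "(A *\<^sub>v v) $ i = (\<Sum>j<k. A $$ (i, j) * v $ j)"
  using assms by (auto simp: scalar_prod_def lessThan_atLeast0 intro!: sum.cong)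

lemma mult_mat_vec_vsum:
  assumes A: "A \<in> carrier_mat n k" and w: "\<And>\<nu>. \<nu> \<in> S \<Longrightarrow> w \<nu> \<in> carrier_vec k"
  shows "A *\<^sub>v vsum k S w = vsum n S (\<lambda>\<nu>. A *\<^sub>v w \<nu>)"
proof (rule eq_vecI)
  fix i assume "i < dim_vec (vsum n S (\<lambda>\<nu>. A *\<^sub>v w \<nu>))"
  hence i: "i < n" by (simp add: vsum_def)
  have "(A *\<^sub>v vsum k S w) $ i = (\<Sum>j<k. A $$ (i, j) * (\<Sum>\<nu>\<in>S. w \<nu> $ j))"
    by (subst mult_mat_vec_index[OF A _ i]) (auto simp: vsum_def)
  also have "\<dots> = (\<Sum>\<nu>\<in>S. \<Sum>j<k. A $$ (i, j) * w \<nu> $ j)"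
    unfolding sum_distrib_left by (rule sum.swap)
  also have "\<dots> = (\<Sum>\<nu>\<in>S. (A *\<^sub>v w \<nu>) $ i)"
    by (intro sum.cong refl mult_mat_vec_index[OF A w i, symmetric])
  finally show "(A *\<^sub>v vsum k S w) $ i = vsum n S (\<lambda>\<nu>. A *\<^sub>v w \<nu>) $ i"
    using i by (simp add: vsum_def)
qed (use A in \<open>simp add: vsum_def\<close>)

lemma scalar_prod_vsum_left:
  assumes "x \<in> carrier_vec n" "\<And>\<nu>. \<nu> \<in> S \<Longrightarrow> w \<nu> \<in> carrier_vec n"
  shows "scalar_prod (vsum n S w) x = (\<Sum>\<nu>\<in>S. scalar_prod (w \<nu>) x)"
  using assms unfolding scalar_prod_def vsum_def
  by (simp add: sum_distrib_right sum.swap[of _ _ S])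

lemma mult_mat_vec_cols:
  assumes P: "P \<in> carrier_mat n k" and b: "b \<in> carrier_vec k"
  shows "P *\<^sub>v b = vsum n {..<k} (\<lambda>j. b $ j \<cdot>\<^sub>v col P j)"
  using assms by (intro eq_vecI)
    (auto simp: vsum_def scalar_prod_def lessThan_atLeast0 mult.commute intro!: sum.cong)

lemma conjugate_vsum:
  assumes "\<And>\<nu>. \<nu> \<in> S \<Longrightarrow> w \<nu> \<in> carrier_vec n"
  shows "conjugate (vsum n S w) = vsum n S (\<lambda>\<nu>. conjugate (w \<nu>))"
proof (rule eq_vecI)
  fix i assume "i < dim_vec (vsum n S (\<lambda>\<nu>. conjugate (w \<nu>)))"
  hence i: "i < n" by (simp add: vsum_def)
  have "conjugate (w \<nu>) $ i = cnj (w \<nu> $ i)" if "\<nu> \<in> S" for \<nu>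
    using assms[OF that] i by simp
  thus "conjugate (vsum n S w) $ i = vsum n S (\<lambda>\<nu>. conjugate (w \<nu>)) $ i"
    using i by (simp add: vsum_def)
qed (simp add: vsum_def)

lemma scalar_prod_vsum_right:
  assumes "x \<in> carrier_vec n" "\<And>\<nu>. \<nu> \<in> S \<Longrightarrow> w \<nu> \<in> carrier_vec n"
  shows "scalar_prod x (vsum n S w) = (\<Sum>\<nu>\<in>S. scalar_prod x (w \<nu>))"
proof -
  have "scalar_prod x (vsum n S w) = (\<Sum>i<n. \<Sum>\<nu>\<in>S. x $ i * w \<nu> $ i)"
    by (simp add: scalar_prod_def vsum_def sum_distrib_left lessThan_atLeast0)
  also have "\<dots> = (\<Sum>\<nu>\<in>S. \<Sum>i<n. x $ i * w \<nu> $ i)"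
    by (rule sum.swap)
  also have "\<dots> = (\<Sum>\<nu>\<in>S. scalar_prod x (w \<nu>))"
    by (intro sum.cong refl) (simp add: scalar_prod_def lessThan_atLeast0 carrier_vecD[OF assms(2)])
  finally show ?thesis .
qed

section \<open>Hermitian matrices: real eigenvalues and orthogonal eigenvectors\<close>

locale hermitian =
  fixes A :: "complex mat" and n :: nat
  assumes A: "A \<in> carrier_mat n n" and herm: "hermitian_mat A"
begin

lemma index_cnj:
  assumes "i < n" "j < n"
  shows "cnj (A $$ (j, i)) = A $$ (i, j)"
proof -
  have "mat_adjoint A $$ (i, j) = cnj (A $$ (j, i))"
    using A assms by (simp add: mat_adjoint_def mat_of_rows_index)
  thus ?thesis using herm by (simp add: hermitian_mat_def)
qed

text \<open>The form in which hermiticity enters every later argument: expand both sides into double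
  sums, swap them and apply \<open>index_cnj\<close> entrywise.\<close>

lemma self_adjoint:
  assumes v: "v \<in> carrier_vec n" and w: "w \<in> carrier_vec n"
  shows "(A *\<^sub>v v) \<bullet>c w = v \<bullet>c (A *\<^sub>v w)"
proof -
  have "(A *\<^sub>v v) \<bullet>c w = (\<Sum>i<n. (\<Sum>j<n. A $$ (i, j) * v $ j) * cnj (w $ i))"
    using v w A mult_mat_vec_index[OF A v]
    by (auto simp: scalar_prod_def lessThan_atLeast0 simp del: index_mult_mat_vec intro!: sum.cong)
  also have "\<dots> = (\<Sum>j<n. \<Sum>i<n. A $$ (i, j) * v $ j * cnj (w $ i))"
    unfolding sum_distrib_right by (rule sum.swap)
  also have "\<dots> = (\<Sum>j<n. v $ j * cnj (\<Sum>i<n. A $$ (j, i) * w $ i))"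
    by (auto simp: sum_distrib_left index_cnj intro!: sum.cong)
  also have "\<dots> = v \<bullet>c (A *\<^sub>v w)"
    using v w A mult_mat_vec_index[OF A w]
    by (auto simp: scalar_prod_def lessThan_atLeast0 simp del: index_mult_mat_vec intro!: sum.cong)
  finally show ?thesis .
qed

text \<open>Moving \<open>A\<close> across \<open>v \<bullet>c v\<close> for an eigenvector
  \<open>v\<close> turns the factor \<open>\<mu>\<close> into its conjugate, and
  \<open>v \<bullet>c v\<close> is nonzero.\<close>

lemma eigenvalue_real:
  assumes "eigenvalue A \<mu>"
  shows "cnj \<mu> = \<mu>"
proof -
  obtain v where v: "v \<in> carrier_vec n" "v \<noteq> 0\<^sub>v n" "A *\<^sub>v v = \<mu> \<cdot>\<^sub>v v"
    using assms A unfolding eigenvalue_def eigenvector_def by auto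
  have "\<mu> * (v \<bullet>c v) = cnj \<mu> * (v \<bullet>c v)"
    using self_adjoint[OF v(1) v(1)] v by (simp add: conjugate_smult_vec)
  thus ?thesis using v by simp
qed

lemma eigenvectors_orthogonal:
  assumes "v \<in> carrier_vec n" "w \<in> carrier_vec n"
    and "A *\<^sub>v v = \<mu> \<cdot>\<^sub>v v" "A *\<^sub>v w = \<nu> \<cdot>\<^sub>v w" "cnj \<nu> = \<nu>" "\<mu> \<noteq> \<nu>"
  shows "v \<bullet>c w = 0"
proof -
  have "\<mu> * (v \<bullet>c w) = \<nu> * (v \<bullet>c w)"
    using self_adjoint[OF assms(1,2)] assms by (simp add: conjugate_smult_vec)
  thus ?thesis using assms by simp
qed

section \<open>Decomposition of vectors into eigenvectors\<close>

text \<open>Components may be zero, so every decomposition is indexed by the whole spectrum.\<close>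

definition eigen_decomp :: "(complex \<Rightarrow> complex vec) \<Rightarrow> complex vec \<Rightarrow> bool" where
  "eigen_decomp w v \<longleftrightarrow>
     (\<forall>\<nu>\<in>spectrum A. w \<nu> \<in> carrier_vec n \<and> A *\<^sub>v w \<nu> = \<nu> \<cdot>\<^sub>v w \<nu>) \<and> v = vsum n (spectrum A) w"

text \<open>Excludes Jordan chains of length two. Pairing \<open>A *\<^sub>v x\<close> with
  \<open>y\<close> and moving \<open>A\<close> across makes the terms
  \<open>\<mu> * (x \<bullet>c y)\<close> cancel, as \<open>\<mu>\<close> is real, which leaves
  \<open>y \<bullet>c y = 0\<close>.\<close>

lemma generalized_eigenvector:
  assumes x: "x \<in> carrier_vec n" and y: "y \<in> carrier_vec n"
    and "cnj \<mu> = \<mu>" and "A *\<^sub>v x = \<mu> \<cdot>\<^sub>v x + y" and "A *\<^sub>v y = \<mu> \<cdot>\<^sub>v y"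
  shows "y = 0\<^sub>v n"
proof -
  have "(A *\<^sub>v x) \<bullet>c y = x \<bullet>c (A *\<^sub>v y)"
    by (rule self_adjoint[OF x y])
  hence "\<mu> * (x \<bullet>c y) + y \<bullet>c y = \<mu> * (x \<bullet>c y)"
    using assms by (simp add: conjugate_smult_vec add_scalar_prod_distrib[of _ n])
  thus ?thesis using y by simp
qed

text \<open>Dividing the components of \<open>y\<close> by \<open>\<nu> - \<mu>\<close> solves the equation away from \<open>\<mu>\<close>. The rest of \<open>v\<close>
  is a generalized eigenvector for \<open>\<mu>\<close>, hence an eigenvector.\<close>

lemma eigen_decomp_step:
  assumes v: "v \<in> carrier_vec n" and \<mu>: "\<mu> \<in> spectrum A"
    and dec: "eigen_decomp w y" and eq: "A *\<^sub>v v = \<mu> \<cdot>\<^sub>v v + y"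
  shows "\<exists>w'. eigen_decomp w' v"
proof -
  define S where "S = spectrum A"
  have fin: "finite S" unfolding S_def by (rule card_finite_spectrum[OF A])
  have \<mu>S: "\<mu> \<in> S" using \<mu> by (simp add: S_def)
  have w: "w \<nu> \<in> carrier_vec n" "A *\<^sub>v w \<nu> = \<nu> \<cdot>\<^sub>v w \<nu>" if "\<nu> \<in> S" for \<nu>
    using dec that by (auto simp: eigen_decomp_def S_def)
  have y: "y = vsum n S w" using dec by (simp add: eigen_decomp_def S_def)
  \<comment> \<open>At \<open>\<nu> = \<mu>\<close> the quotient is 0 by convention; this entry is
    left out of the sums below and finally overwritten by \<open>x\<close>.\<close>
  define g where "g \<nu> = (1 / (\<nu> - \<mu>)) \<cdot>\<^sub>v w \<nu>" for \<nu>
  have g: "g \<nu> \<in> carrier_vec n" "A *\<^sub>v g \<nu> = \<nu> \<cdot>\<^sub>v g \<nu>" if "\<nu> \<in> S" for \<nu>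
    using w[OF that] A by (auto simp: g_def mult_mat_vec smult_smult_assoc mult.commute)
  define x where "x = v - vsum n (S - {\<mu>}) g"
  have x: "x \<in> carrier_vec n" using v by (simp add: x_def)
  have "A *\<^sub>v x = A *\<^sub>v v - vsum n (S - {\<mu>}) (\<lambda>\<nu>. A *\<^sub>v g \<nu>)"
    unfolding x_def mult_minus_distrib_mat_vec[OF A v vsum_carrier]
    by (subst mult_mat_vec_vsum[OF A]) (auto simp: g)
  also have "\<dots> = \<mu> \<cdot>\<^sub>v v + vsum n S w - vsum n (S - {\<mu>}) (\<lambda>\<nu>. \<nu> \<cdot>\<^sub>v g \<nu>)"
    unfolding eq y by (auto simp: vsum_def g intro!: eq_vecI sum.cong)
  also have "\<dots> = \<mu> \<cdot>\<^sub>v x + w \<mu>"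
  proof (rule eq_vecI)
    fix i assume "i < dim_vec (\<mu> \<cdot>\<^sub>v x + w \<mu>)"
    hence i: "i < n" using w(1)[OF \<mu>S] by simp
    have "(\<mu> \<cdot>\<^sub>v v + vsum n S w - vsum n (S - {\<mu>}) (\<lambda>\<nu>. \<nu> \<cdot>\<^sub>v g \<nu>)) $ i
          = \<mu> * v $ i + (\<Sum>\<nu>\<in>S. w \<nu> $ i) - (\<Sum>\<nu>\<in>S-{\<mu>}. \<nu> * g \<nu> $ i)"
      using i v by (auto simp: vsum_def carrier_vecD[OF g(1)] intro!: sum.cong)
    also have "(\<Sum>\<nu>\<in>S. w \<nu> $ i) = w \<mu> $ i + (\<Sum>\<nu>\<in>S-{\<mu>}. w \<nu> $ i)"
      by (rule sum.remove[OF fin \<mu>S])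
    \<comment> \<open>Off \<open>\<mu>\<close>, \<open>(\<nu> - \<mu>)\<close> times
      \<open>g \<nu>\<close> is \<open>w \<nu>\<close>, so the components of \<open>y\<close> other
      than \<open>w \<mu>\<close> are absorbed into \<open>\<mu> \<cdot>\<^sub>v x\<close>.\<close>
    also have "(\<Sum>\<nu>\<in>S-{\<mu>}. w \<nu> $ i) = (\<Sum>\<nu>\<in>S-{\<mu>}. \<nu> * g \<nu> $ i - \<mu> * g \<nu> $ i)"
    proof (intro sum.cong refl)
      fix \<nu> assume \<nu>: "\<nu> \<in> S - {\<mu>}"
      have "\<nu> * g \<nu> $ i - \<mu> * g \<nu> $ i = (\<nu> - \<mu>) * (1 / (\<nu> - \<mu>) * w \<nu> $ i)"
        using \<nu> w(1)[of \<nu>] i by (simp add: g_def left_diff_distrib diff_divide_distrib)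
      thus "w \<nu> $ i = \<nu> * g \<nu> $ i - \<mu> * g \<nu> $ i" using \<nu> by simp
    qed
    finally show "(\<mu> \<cdot>\<^sub>v v + vsum n S w - vsum n (S - {\<mu>}) (\<lambda>\<nu>. \<nu> \<cdot>\<^sub>v g \<nu>)) $ i
          = (\<mu> \<cdot>\<^sub>v x + w \<mu>) $ i"
      using i v w(1)[OF \<mu>S]
      by (simp add: x_def vsum_def sum_subtractf sum_distrib_left algebra_simps)
  qed (use w(1)[OF \<mu>S] in \<open>simp add: x_def vsum_def\<close>)
  finally have Ax: "A *\<^sub>v x = \<mu> \<cdot>\<^sub>v x + w \<mu>" .
  have "w \<mu> = 0\<^sub>v n"
    using generalized_eigenvector[OF x w(1)[OF \<mu>S] _ Ax w(2)[OF \<mu>S]] \<mu> eigenvalue_real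
    by (auto simp: spectrum_def)
  hence Ax: "A *\<^sub>v x = \<mu> \<cdot>\<^sub>v x" using Ax x by simp
  have "v = vsum n S (g(\<mu> := x))"
  proof (rule eq_vecI)
    fix i assume "i < dim_vec (vsum n S (g(\<mu> := x)))"
    hence i: "i < n" by (simp add: vsum_def)
    show "v $ i = vsum n S (g(\<mu> := x)) $ i"
      using i v by (simp add: vsum_def sum.remove[OF fin \<mu>S] x_def)
  qed (use v in \<open>simp add: vsum_def\<close>)
  hence "eigen_decomp (g(\<mu> := x)) v"
    using x Ax g by (auto simp: eigen_decomp_def S_def)
  thus ?thesis by blast
qed

text \<open>Each eigenspace is closed under linear combinations, so the decompositions can be
  combined one eigenvalue at a time.\<close>

lemma eigen_decomp_lincomb:
  assumes "\<And>j. j \<in> J \<Longrightarrow> \<exists>w. eigen_decomp w (x j)"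
  shows "\<exists>w. eigen_decomp w (vsum n J (\<lambda>j. a j \<cdot>\<^sub>v x j))"
proof -
  obtain w where w: "\<And>j. j \<in> J \<Longrightarrow> eigen_decomp (w j) (x j)"
    using assms by metis
  define g where "g \<nu> = vsum n J (\<lambda>j. a j \<cdot>\<^sub>v w j \<nu>)" for \<nu>
  have wc: "w j \<nu> \<in> carrier_vec n" "A *\<^sub>v w j \<nu> = \<nu> \<cdot>\<^sub>v w j \<nu>"
    if "j \<in> J" "\<nu> \<in> spectrum A" for j \<nu>
    using w[OF that(1)] that(2) by (auto simp: eigen_decomp_def)
  have "A *\<^sub>v g \<nu> = \<nu> \<cdot>\<^sub>v g \<nu>" if \<nu>: "\<nu> \<in> spectrum A" for \<nu>
  proof -
    have "A *\<^sub>v g \<nu> = vsum n J (\<lambda>j. A *\<^sub>v (a j \<cdot>\<^sub>v w j \<nu>))"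
      unfolding g_def by (rule mult_mat_vec_vsum[OF A]) (simp add: wc \<nu>)
    also have "\<dots> = \<nu> \<cdot>\<^sub>v g \<nu>"
    proof (rule eq_vecI)
      fix i assume "i < dim_vec (\<nu> \<cdot>\<^sub>v g \<nu>)"
      hence i: "i < n" by (simp add: g_def vsum_def)
      have "(A *\<^sub>v (a j \<cdot>\<^sub>v w j \<nu>)) $ i = \<nu> * (a j * w j \<nu> $ i)" if "j \<in> J" for j
        using wc[OF that \<nu>] mult_mat_vec[OF A wc(1)[OF that \<nu>]] i by simp
      moreover have "(a j \<cdot>\<^sub>v w j \<nu>) $ i = a j * w j \<nu> $ i" if "j \<in> J" for j
        using wc[OF that \<nu>] i by simp
      ultimately show "vsum n J (\<lambda>j. A *\<^sub>v (a j \<cdot>\<^sub>v w j \<nu>)) $ i = (\<nu> \<cdot>\<^sub>v g \<nu>) $ i"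
        using i by (simp add: g_def vsum_def sum_distrib_left)
    qed (simp add: g_def vsum_def)
    finally show ?thesis .
  qed
  moreover have "vsum n J (\<lambda>j. a j \<cdot>\<^sub>v x j) = vsum n (spectrum A) g"
  proof (rule eq_vecI)
    fix i assume "i < dim_vec (vsum n (spectrum A) g)"
    hence i: "i < n" by (simp add: vsum_def)
    have "(\<Sum>j\<in>J. (a j \<cdot>\<^sub>v x j) $ i) = (\<Sum>j\<in>J. \<Sum>\<nu>\<in>spectrum A. (a j \<cdot>\<^sub>v w j \<nu>) $ i)"
    proof (intro sum.cong refl)
      fix j assume j: "j \<in> J"
      have xj: "x j = vsum n (spectrum A) (w j)" using w[OF j] by (simp add: eigen_decomp_def)
      have "(a j \<cdot>\<^sub>v w j \<nu>) $ i = a j * w j \<nu> $ i" if "\<nu> \<in> spectrum A" for \<nu>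
        using wc(1)[OF j that] i by simp
      thus "(a j \<cdot>\<^sub>v x j) $ i = (\<Sum>\<nu>\<in>spectrum A. (a j \<cdot>\<^sub>v w j \<nu>) $ i)"
        using i by (simp add: xj vsum_def sum_distrib_left)
    qed
    also have "\<dots> = (\<Sum>\<nu>\<in>spectrum A. \<Sum>j\<in>J. (a j \<cdot>\<^sub>v w j \<nu>) $ i)"
      by (rule sum.swap)
    finally show "vsum n J (\<lambda>j. a j \<cdot>\<^sub>v x j) $ i = vsum n (spectrum A) g $ i"
      using i by (simp add: g_def vsum_def)
  qed (simp add: vsum_def)
  ultimately show ?thesis
    unfolding eigen_decomp_def by (intro exI[of _ g]) (simp add: g_def)
qed

text \<open>Every column of the matrix triangularising \<^term>\<open>A\<close> is decomposable, by induction along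
  the triangular form: \<^term>\<open>A\<close> maps the \<open>i\<close>-th column to a multiple of itself plus a combination of
  earlier columns.\<close>

lemma eigen_decomp_exists:
  assumes v: "v \<in> carrier_vec n"
  shows "\<exists>w. eigen_decomp w v"
proof -
  obtain es where "char_poly A = (\<Prod>a\<leftarrow>es. [:- a, 1:])"
    using char_poly_factorized[OF A] by auto
  then obtain B where B: "B \<in> carrier_mat n n" "upper_triangular B" "similar_mat A B"
    using schur_decomposition_exists[OF A] by blast
  then obtain P Q where PQ: "similar_mat_wit A B P Q" by (auto simp: similar_mat_def)
  from similar_mat_witD2[OF A PQ] have P: "P \<in> carrier_mat n n" and Q: "Q \<in> carrier_mat n n"
    and id: "P * Q = 1\<^sub>m n" "Q * P = 1\<^sub>m n" and AB: "A = P * B * Q" by auto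
  have AP: "A * P = P * B"
  proof -
    have "A * P = (P * B) * (Q * P)"
      unfolding AB using P B(1) Q by (intro assoc_mult_mat[of _ n n _ n _ n]) auto
    thus ?thesis using P B(1) id by simp
  qed
  \<comment> \<open>The characteristic polynomial of a triangular matrix has the diagonal entries as
    roots, and similarity preserves it.\<close>
  have spec: "B $$ (i, i) \<in> spectrum A" if "i < n" for i
  proof -
    have "poly (char_poly B) (B $$ (i, i)) = 0"
      unfolding char_poly_upper_triangular[OF B(1,2)]
      using B(1) that by (auto simp: poly_prod_list prod_list_zero_iff diag_mat_def)
    thus ?thesis
      using char_poly_similar[OF B(3)] spectrum_root_char_poly[OF A] by simp
  qed
  have col: "\<exists>w. eigen_decomp w (col P i)" if "i < n" for i
    using that
  proof (induction i rule: less_induct)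
    case (less i)
    let ?y = "vsum n {..<i} (\<lambda>j. B $$ (j, i) \<cdot>\<^sub>v col P j)"
    \<comment> \<open>For \<open>i = 0\<close> this is the empty sum, so the induction needs no
      separate base case.\<close>
    obtain w where w: "eigen_decomp w ?y"
      using eigen_decomp_lincomb[of "{..<i}" "col P"] less by fastforce
    have "A *\<^sub>v col P i = col (A * P) i"
      using col_mult2[OF A P less.prems] by simp
    also have "\<dots> = P *\<^sub>v col B i"
      unfolding AP by (rule col_mult2[OF P B(1) less.prems])
    also have "\<dots> = vsum n {..<n} (\<lambda>j. B $$ (j, i) \<cdot>\<^sub>v col P j)"
      using B(1) less.prems by (subst mult_mat_vec_cols[OF P]) (auto simp: vsum_def)
    also have "\<dots> = B $$ (i, i) \<cdot>\<^sub>v col P i + ?y"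
    proof (rule eq_vecI)
      fix k assume "k < dim_vec (B $$ (i, i) \<cdot>\<^sub>v col P i + ?y)"
      hence k: "k < n" by (simp add: vsum_def)
      \<comment> \<open>Entries of \<open>B\<close> below the diagonal vanish, so only the columns
        up to \<open>i\<close> contribute.\<close>
      have "(\<Sum>j<n. (B $$ (j, i) \<cdot>\<^sub>v col P j) $ k)
          = (\<Sum>j\<in>insert i {..<i}. (B $$ (j, i) \<cdot>\<^sub>v col P j) $ k)"
        using less.prems k P B upper_triangularD[OF B(2)]
        by (intro sum.mono_neutral_right) auto
      thus "vsum n {..<n} (\<lambda>j. B $$ (j, i) \<cdot>\<^sub>v col P j) $ k
          = (B $$ (i, i) \<cdot>\<^sub>v col P i + ?y) $ k"
        using k P by (simp add: vsum_def)
    qed (simp add: vsum_def)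
    finally have "A *\<^sub>v col P i = B $$ (i, i) \<cdot>\<^sub>v col P i + ?y" .
    thus ?case
      using eigen_decomp_step[OF _ spec[OF less.prems] w] P less.prems by auto
  qed
  \<comment> \<open>The columns of \<open>P\<close> form a basis, in which \<open>v\<close> has the
    coordinates \<open>Q *\<^sub>v v\<close>.\<close>
  have "v = (P * Q) *\<^sub>v v" using v id by simp
  also have "\<dots> = P *\<^sub>v (Q *\<^sub>v v)" using P Q v by (rule assoc_mult_mat_vec)
  also have "\<dots> = vsum n {..<n} (\<lambda>j. (Q *\<^sub>v v) $ j \<cdot>\<^sub>v col P j)"
    using Q v by (intro mult_mat_vec_cols[OF P]) simp
  finally show ?thesis
    using eigen_decomp_lincomb[of "{..<n}" "col P" "\<lambda>j. (Q *\<^sub>v v) $ j"] col by simp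
qed

section \<open>Moments of the spectral measure of a vector\<close>

text \<open>The weights are the squared norms of the components of \<open>v\<close>. They do not
  depend on \<open>k\<close>, because \<open>A ^\<^sub>m k\<close> only scales the component for
  \<open>\<nu>\<close> by \<open>\<nu> ^ k\<close>.\<close>

lemma spectral_moments:
  assumes v: "v \<in> carrier_vec n"
  obtains p :: "complex \<Rightarrow> real" where
    "\<And>\<nu>. \<nu> \<in> spectrum A \<Longrightarrow> p \<nu> \<ge> 0"
    "\<And>k. ((A ^\<^sub>m k) *\<^sub>v v) \<bullet>c v = (\<Sum>\<nu>\<in>spectrum A. complex_of_real (p \<nu>) * \<nu> ^ k)"
proof -
  define S where "S = spectrum A"
  obtain w where "eigen_decomp w v" using eigen_decomp_exists[OF v] ..
  hence w: "\<And>\<nu>. \<nu> \<in> S \<Longrightarrow> w \<nu> \<in> carrier_vec n"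
    "\<And>\<nu>. \<nu> \<in> S \<Longrightarrow> A *\<^sub>v w \<nu> = \<nu> \<cdot>\<^sub>v w \<nu>" and vw: "v = vsum n S w"
    by (auto simp: eigen_decomp_def S_def)
  have fin: "finite S" unfolding S_def by (rule card_finite_spectrum[OF A])
  have pow: "(A ^\<^sub>m k) *\<^sub>v w \<nu> = \<nu> ^ k \<cdot>\<^sub>v w \<nu>" if "\<nu> \<in> S" for k \<nu>
  proof (induction k)
    case 0
    then show ?case using w(1)[OF that] A by simp
  next
    case (Suc k)
    have "(A ^\<^sub>m Suc k) *\<^sub>v w \<nu> = (A ^\<^sub>m k) *\<^sub>v (\<nu> \<cdot>\<^sub>v w \<nu>)"
      using A w[OF that] by (simp add: assoc_mult_mat_vec[of _ n n _ n])
    also have "\<dots> = \<nu> \<cdot>\<^sub>v ((A ^\<^sub>m k) *\<^sub>v w \<nu>)"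
      using A w(1)[OF that] by (intro mult_mat_vec[of _ n n]) auto
    finally show ?case using Suc by (simp add: smult_smult_assoc)
  qed
  \<comment> \<open>Components for different eigenvalues are orthogonal, so pairing with
    \<open>v\<close> sees only the component itself.\<close>
  have inner: "w \<nu> \<bullet>c v = w \<nu> \<bullet>c w \<nu>" if \<nu>: "\<nu> \<in> S" for \<nu>
  proof -
    have "w \<nu> \<bullet>c v = (\<Sum>\<kappa>\<in>S. w \<nu> \<bullet>c w \<kappa>)"
      unfolding vw using w \<nu> by (simp add: conjugate_vsum scalar_prod_vsum_right)
    also have "\<dots> = (\<Sum>\<kappa>\<in>{\<nu>}. w \<nu> \<bullet>c w \<kappa>)"
    proof (rule sum.mono_neutral_right[OF fin])
      show "\<forall>\<kappa>\<in>S - {\<nu>}. w \<nu> \<bullet>c w \<kappa> = 0"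
      proof
        fix \<kappa> assume k: "\<kappa> \<in> S - {\<nu>}"
        hence "cnj \<kappa> = \<kappa>" using eigenvalue_real by (auto simp: S_def spectrum_def)
        thus "w \<nu> \<bullet>c w \<kappa> = 0"
          using k \<nu> w by (intro eigenvectors_orthogonal[of _ _ \<nu> \<kappa>]) auto
      qed
    qed (use \<nu> in auto)
    finally show ?thesis by simp
  qed
  \<comment> \<open>In the order on complex numbers, being \<ge> 0 includes being real, so taking
    \<open>Re\<close> below loses nothing.\<close>
  have nonneg: "w \<nu> \<bullet>c w \<nu> \<ge> 0" for \<nu>
    by (rule conjugate_square_ge_0_vec)
  show thesis
  proof
    show "Re (w \<nu> \<bullet>c w \<nu>) \<ge> 0" for \<nu>
      using nonneg[of \<nu>] by (simp add: less_eq_complex_def)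
    have re: "complex_of_real (Re (w \<nu> \<bullet>c w \<nu>)) = w \<nu> \<bullet>c w \<nu>" for \<nu>
      using nonneg[of \<nu>] by (simp add: less_eq_complex_def complex_eq_iff)
    fix k
    have "((A ^\<^sub>m k) *\<^sub>v v) \<bullet>c v = vsum n S (\<lambda>\<nu>. (A ^\<^sub>m k) *\<^sub>v w \<nu>) \<bullet>c v"
      using A w(1) by (subst vw) (simp add: mult_mat_vec_vsum[of _ n n])
    also have "\<dots> = (\<Sum>\<nu>\<in>S. ((A ^\<^sub>m k) *\<^sub>v w \<nu>) \<bullet>c v)"
      using A w(1) v
      by (intro scalar_prod_vsum_left mult_mat_vec_carrier[of _ n n] pow_carrier_mat) auto
    also have "\<dots> = (\<Sum>\<nu>\<in>S. (w \<nu> \<bullet>c w \<nu>) * \<nu> ^ k)"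
      using w(1) v by (intro sum.cong refl) (simp add: pow inner)
    finally show "((A ^\<^sub>m k) *\<^sub>v v) \<bullet>c v
        = (\<Sum>\<nu>\<in>spectrum A. complex_of_real (Re (w \<nu> \<bullet>c w \<nu>)) * \<nu> ^ k)"
      by (simp only: re S_def)
  qed
qed

end

section \<open>Power series and the intermediate value argument\<close>

text \<open>Between \<open>\<bar>x\<bar>\<close> and the radius there is a point \<open>K\<close> at
  which the series still converges; this gives continuity at \<open>x\<close>.\<close>

lemma continuous_on_power_series:
  fixes c :: "nat \<Rightarrow> real"
  assumes "\<And>x. x \<in> real_domain c \<Longrightarrow> (\<lambda>k. c k * x ^ k) sums f x"
  shows "continuous_on (real_domain c) f"
proof -
  have "isCont (\<lambda>x. \<Sum>k. c k * x ^ k) x" if x: "x \<in> real_domain c" for x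
  proof -
    obtain K where K: "ereal \<bar>x\<bar> < ereal K" "ereal K < conv_radius c"
      using ereal_dense2[of "ereal \<bar>x\<bar>" "conv_radius c"] x by (auto simp: real_domain_def)
    hence "(\<lambda>k. c k * K ^ k) sums f K" by (intro assms) (auto simp: real_domain_def)
    thus ?thesis using K by (intro isCont_powser[of c K]) (auto simp: sums_iff)
  qed
  hence "continuous_on (real_domain c) (\<lambda>x. \<Sum>k. c k * x ^ k)"
    by (simp add: continuous_at_imp_continuous_on)
  thus ?thesis
    by (rule continuous_on_eq) (metis assms sums_unique)
qed

theorem theorem4p2:
  fixes A :: "complex mat" and m :: nat
    and c :: "nat \<Rightarrow> real" and f :: "real \<Rightarrow> real" and t :: real
  assumes "m > 0"
    and "A \<in> carrier_mat m m"
    and "hermitian_mat A"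
    and "conv_radius c > 0"
    and "\<And>x. x \<in> real_domain c \<Longrightarrow> (\<lambda>k. c k * x ^ k) sums f x"
    and "strict_mono_on (real_domain c) f"
    and "ereal t > ereal (spectral_radius A) / conv_radius c"
  shows
    "summable (\<lambda>k. complex_of_real (c k) * walk_num A k * complex_of_real t powi (- int k)) \<and>
     (let s = (1 / of_nat m) *
            (\<Sum>k. complex_of_real (c k) * walk_num A k * complex_of_real t powi (- int k))
      in s \<in> \<real> \<and> Re s \<in> f ` real_domain c \<and>
         t * the_inv_into (real_domain c) f (Re s) \<le> largest_eigenvalue A)"
proof -
  interpret hermitian A m by standard (fact assms)+
  define S where "S = spectrum A"
  have fin: "finite S" and ne: "S \<noteq> {}"
    unfolding S_def by (rule card_finite_spectrum[OF assms(2)], rule spectrum_non_empty[OF assms(2,1)])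
  have real: "complex_of_real (Re \<nu>) = \<nu>" if "\<nu> \<in> S" for \<nu>
    using eigenvalue_real that by (auto simp: S_def spectrum_def complex_eq_iff)
  have bound: "\<bar>Re \<nu>\<bar> \<le> spectral_radius A" if "\<nu> \<in> S" for \<nu>
  proof -
    have "\<bar>Re \<nu>\<bar> = cmod \<nu>" using real[OF that] by (metis norm_of_real)
    thus ?thesis using spectral_radius_mem_max(2)[OF assms(2,1)] that by (simp add: S_def)
  qed
  have rad: "spectral_radius A \<ge> 0"
    using ne bound by fastforce
  \<comment> \<open>For a finite radius the hypothesis is rearranged; for an infinite one its
    quotient is 0, so it reads \<open>t > 0\<close>.\<close>
  have t: "t > 0" and tR: "ereal (spectral_radius A / t) < conv_radius c"
  proof -
    have "t > 0 \<and> ereal (spectral_radius A / t) < conv_radius c"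
    proof (cases "conv_radius c")
      case (real r)
      with assms(4,7) have r: "r > 0" "spectral_radius A / r < t" by auto
      moreover have "0 \<le> spectral_radius A / r" using rad r by simp
      ultimately have "t > 0" by linarith
      thus ?thesis using r real by (simp add: field_simps)
    qed (use assms(4,7) in auto)
    thus "t > 0" "ereal (spectral_radius A / t) < conv_radius c" by auto
  qed
  have dom: "x \<in> real_domain c" if "\<bar>x\<bar> \<le> spectral_radius A / t" for x
    using that tR by (auto simp: real_domain_def intro: le_less_trans[of _ "ereal (spectral_radius A / t)"])
  have domS: "\<bar>Re \<nu> / t\<bar> \<le> spectral_radius A / t" if "\<nu> \<in> S" for \<nu>
    using bound[OF that] t by (simp add: divide_right_mono)

  define u where "u = ones_vec m"
  \<comment> \<open>As \<open>u\<close> is real, the bilinear product in \<open>walk_num\<close>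
    agrees with the Hermitian form.\<close>
  have u: "u \<in> carrier_vec m" "conjugate u = u"
    by (auto simp: u_def ones_vec_def intro!: eq_vecI)
  obtain p :: "complex \<Rightarrow> real" where p: "\<And>\<nu>. \<nu> \<in> S \<Longrightarrow> p \<nu> \<ge> 0"
    and mom: "\<And>k. ((A ^\<^sub>m k) *\<^sub>v u) \<bullet>c u = (\<Sum>\<nu>\<in>S. complex_of_real (p \<nu>) * \<nu> ^ k)"
    using spectral_moments[OF u(1)] unfolding S_def by blast
  have N: "walk_num A k = complex_of_real (\<Sum>\<nu>\<in>S. p \<nu> * Re \<nu> ^ k)" for k
  proof -
    have "walk_num A k = ((A ^\<^sub>m k) *\<^sub>v u) \<bullet>c u"
      using assms(2) u(2) comm_scalar_prod[OF u(1) mult_mat_vec_carrier[OF pow_carrier_mat[OF A] u(1)]]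
      by (simp add: walk_num_def u_def)
    also have "\<dots> = (\<Sum>\<nu>\<in>S. complex_of_real (p \<nu>) * complex_of_real (Re \<nu>) ^ k)"
      unfolding mom using real by simp
    finally show ?thesis by simp
  qed
  \<comment> \<open>This is the moment for \<open>k = 0\<close>; since \<open>0 ^ 0 = 1\<close>, the
    weight of an eigenvalue 0 is counted too.\<close>
  have psum: "(\<Sum>\<nu>\<in>S. p \<nu>) = m"
  proof -
    have "complex_of_real (\<Sum>\<nu>\<in>S. p \<nu>) = complex_of_real (real m)"
      using N[of 0] walk_num_0[OF assms(2)] by simp
    thus ?thesis by (simp only: of_real_eq_iff)
  qed

  \<comment> \<open>The value of the series before division by \<open>m\<close>, found by exchanging
    the finite sum over the spectrum with the power series.\<close>
  define F where "F = (\<Sum>\<nu>\<in>S. p \<nu> * f (Re \<nu> / t))"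
  have "(\<lambda>k. \<Sum>\<nu>\<in>S. p \<nu> * (c k * (Re \<nu> / t) ^ k)) sums F"
    unfolding F_def by (intro sums_sum sums_mult assms(5) dom domS)
  hence "(\<lambda>k. complex_of_real (\<Sum>\<nu>\<in>S. p \<nu> * (c k * (Re \<nu> / t) ^ k))) sums complex_of_real F"
    by (rule sums_of_real)
  moreover have "complex_of_real (\<Sum>\<nu>\<in>S. p \<nu> * (c k * (Re \<nu> / t) ^ k))
      = complex_of_real (c k) * walk_num A k * complex_of_real t powi (- int k)" for k
    unfolding N using t
    by (simp add: power_int_minus sum_distrib_left sum_distrib_right power_divide field_simps)
  ultimately have sums: "(\<lambda>k. complex_of_real (c k) * walk_num A k * complex_of_real t powi (- int k))
      sums complex_of_real F"
    by simp

  define lo hi where "lo = Min (Re ` S)" and "hi = Max (Re ` S)"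
  have lohi: "lo \<le> Re \<nu>" "Re \<nu> \<le> hi" if "\<nu> \<in> S" for \<nu>
    using that fin by (auto simp: lo_def hi_def)
  have "lo \<in> Re ` S" "hi \<in> Re ` S"
    using fin ne by (auto simp: lo_def hi_def intro!: Min_in Max_in)
  hence lohi_dom: "\<bar>lo / t\<bar> \<le> spectral_radius A / t" "\<bar>hi / t\<bar> \<le> spectral_radius A / t"
    using domS by auto
  \<comment> \<open>All eigenvalues are real, so restricting to real \<open>x\<close> omits none of
    them.\<close>
  have "{x. eigenvalue A (complex_of_real x)} = Re ` S"
    using real by (force simp: S_def spectrum_def)
  hence largest: "largest_eigenvalue A = hi"
    by (simp add: largest_eigenvalue_def hi_def)
  have sub: "{lo / t..hi / t} \<subseteq> real_domain c"
  proof
    fix x assume "x \<in> {lo / t..hi / t}"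
    hence "lo / t \<le> x" "x \<le> hi / t" by auto
    hence "\<bar>x\<bar> \<le> spectral_radius A / t" using lohi_dom by linarith
    thus "x \<in> real_domain c" by (rule dom)
  qed
  have mono: "f x \<le> f y" if "x \<in> real_domain c" "y \<in> real_domain c" "x \<le> y" for x y
    using strict_mono_onD[OF assms(6) that(1,2)] that(3) by (cases "x = y") auto
  have between: "f (lo / t) \<le> f (Re \<nu> / t)" "f (Re \<nu> / t) \<le> f (hi / t)" if "\<nu> \<in> S" for \<nu>
    using that t lohi[OF that] lohi_dom domS by (auto intro!: mono dom divide_right_mono)
  \<comment> \<open>Writing \<open>m\<close> as the sum of the nonnegative weights reduces both
    bounds to termwise comparisons.\<close>
  have "m * f (lo / t) \<le> F" "F \<le> m * f (hi / t)"
    unfolding psum[symmetric] F_def sum_distrib_right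
    by (auto intro!: sum_mono mult_left_mono p between)
  hence "f (lo / t) \<le> F / m" "F / m \<le> f (hi / t)"
    using assms(1) by (simp_all add: field_simps)
  moreover have "lo / t \<le> hi / t"
    using ne lohi t by (metis all_not_in_conv divide_right_mono less_imp_le order_trans)
  moreover have "continuous_on {lo / t..hi / t} f"
    using continuous_on_power_series[OF assms(5)] sub by (rule continuous_on_subset)
  \<comment> \<open>The point \<open>x\<close> serves twice: it puts \<open>F / m\<close> into the
    range of \<open>f\<close>, and by injectivity it is the value of the inverse there, at most
    \<open>hi / t\<close>.\<close>
  ultimately obtain x where x: "lo / t \<le> x" "x \<le> hi / t" "f x = F / m"
    using IVT'[of f "lo / t" "F / m" "hi / t"] by blast
  have xd: "x \<in> real_domain c" using x sub by auto
  have inv: "the_inv_into (real_domain c) f (F / m) = x"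
    using the_inv_into_f_f[OF strict_mono_on_imp_inj_on[OF assms(6)] xd] x(3) by simp
  have "F / m \<in> f ` real_domain c" using x(3) xd by force
  moreover have "t * x \<le> hi" using x(2) t by (simp add: field_simps)
  moreover have "(1 / of_nat m) * complex_of_real F = complex_of_real (F / m)" by simp
  ultimately show ?thesis
    unfolding Let_def sums_unique[OF sums, symmetric] largest
    using sums inv by (simp only: Re_complex_of_real Reals_of_real sums_iff simp_thms)
qed

end
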